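(* Let $k\ge2$ and $n=2k$. Put $Q_q=(A_{2q-1},B_{2q-1},B_{2q},A_{2q})$ for $1\le q\le k$, let $\Omega_+(k)=Q_1Q_2\cdots Q_k$ (concatenation), and let $\Omega_-(k)=(A_1,A_2,\dots,A_n,B_n,B_{n-1},\dots,B_1)$. Then $$F(MMMVVM,k)=\{\Omega_+(k)\},\qquad F(MVMVMV,k)=\{\Omega_-(k)\}.$$ The other six words $P$ with $\delta_0=\delta_1=-1$ and $\tau=-1$ have the exact singleton state sets $$\begin{array}{c|c}P&F(P,k)\\\hline MMVMMV&\{T_R(\Omega_+(k))\}\\ VVMVVM&\{T_{CR}(\Omega_+(k))\}\\ VVVMMV&\{T_C(\Omega_+(k))\}\\ VMMVMV&\{T_H(\Omega_-(k))\}\\ VMVMVM&\{T_C(\Omega_-(k))\}\\ MVVMVM&\{T_{CH}(\Omega_-(k))\}.\end{array}$$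
   Context: Map and assignment. Let $k\ge2$, $n=2k$. The upper faces are $A_1,\dots,A_n$, the lower faces $B_1,\dots,B_n$. The creases are $H_c=(A_c,B_c)$ ($1\le c\le n$), $U_i=(A_i,A_{i+1})$ and $L_i=(B_i,B_{i+1})$ ($1\le i\le n-1$); the two faces of a crease are its wings. A word $P=(h_0,h_1,u_0,u_1,l_0,l_1)\in\{M,V\}^6$ (written as a six-letter string) assigns to $H_c$ the label $h_{(c-1)\bmod 2}$ and to $U_i,L_i$ the labels $u_{(i-1)\bmod2},l_{(i-1)\bmod2}$. With $M=+1,V=-1$: $\tau=u_0u_1$, $\delta_i=h_0h_1u_il_i$ ($i=0,1$). The assignment is locally flat-foldable if for every $1\le c\le n-1$ an odd number of the four creases $H_c,H_{c+1},U_c,L_c$ (meeting at an interior vertex) are labelled $M$. States. Total orders are written as lists from top (first) to bottom; $x\prec y$ means $x$ comes before $y$. A strict total order of all $4k$ labelled faces is order-valid for $P$ if: (i) Precedence: with $A_c$ in row $r=0$ and $B_c$ in row $r=1$, the face in row $r$, column $c$ is light-up iff $r+c-1$ is even and dark-up otherwise; across each $M$ crease the light-up wing precedes the dark-up wing, across each $V$ crease the dark-up wing precedes the light-up wing. (ii) Noncrossing: every $H_c$ has target class $S$; $U_i$ and $L_i$ have class $E$ for $i$ odd and $W$ for $i$ even; for any two distinct creases of the same target class with disjoint wing sets, with wing positions $a_0<a_1$ and $b_0<b_1$ in the order, neither $a_0<b_0<a_1<b_1$ nor $b_0<a_0<b_1<a_1$. $F(P,k)$ is the set of all order-valid strict total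 orders if $P$ is locally flat-foldable, and $F(P,k)=\varnothing$ otherwise. Symmetry maps. $\phi_R$ exchanges $A_c$ and $B_c$ for all $c$; $\phi_H(A_c)=A_{n+1-c}$, $\phi_H(B_c)=B_{n+1-c}$. For a total order $\Pi$, $\phi(\Pi)$ is elementwise relabelling and $\operatorname{rev}(\Pi)$ reversal. $T_C(\Pi)=\operatorname{rev}(\Pi)$, $T_R(\Pi)=\operatorname{rev}(\phi_R(\Pi))$, $T_H(\Pi)=\operatorname{rev}(\phi_H(\Pi))$, $T_{CR}(\Pi)=\phi_R(\Pi)$, $T_{CH}(\Pi)=\phi_H(\Pi)$. *)

theory Defs
  imports Main
begin

datatype label = M | V

datatype mv_word =
  Word (h0: label) (h1: label) (u0: label) (u1: label) (l0: label) (l1: label)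

definition h :: "mv_word \<Rightarrow> nat \<Rightarrow> label" where
  "h P i = (if i = 0 then h0 P else h1 P)"

definition u :: "mv_word \<Rightarrow> nat \<Rightarrow> label" where
  "u P i = (if i = 0 then u0 P else u1 P)"

definition l :: "mv_word \<Rightarrow> nat \<Rightarrow> label" where
  "l P i = (if i = 0 then l0 P else l1 P)"

fun sign :: "label \<Rightarrow> int" where
  "sign M = 1"
| "sign V = -1"

definition tau :: "mv_word \<Rightarrow> int" where
  "tau P = sign (u P 0) * sign (u P 1)"

definition delta :: "mv_word \<Rightarrow> nat \<Rightarrow> int" where
  "delta P i = sign (h P 0) * sign (h P 1) * sign (u P i) * sign (l P i)"

text \<open>Column and crease indices start at 1 throughout; the constructors at other
  indices are junk, excluded by \<open>faces\<close> and \<open>creases\<close>.\<close>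

datatype face = A nat | B nat

datatype crease = H nat | U nat | L nat

definition faces :: "nat \<Rightarrow> face set" where
  "faces n = A ` {1..n} \<union> B ` {1..n}"

definition creases :: "nat \<Rightarrow> crease set" where
  "creases n = H ` {1..n} \<union> U ` {1..n - 1} \<union> L ` {1..n - 1}"

fun wings :: "crease \<Rightarrow> face set" where
  "wings (H c) = {A c, B c}"
| "wings (U i) = {A i, A (i + 1)}"
| "wings (L i) = {B i, B (i + 1)}"

fun crease_label :: "mv_word \<Rightarrow> crease \<Rightarrow> label" where
  "crease_label P (H c) = h P ((c - 1) mod 2)"
| "crease_label P (U i) = u P ((i - 1) mod 2)"
| "crease_label P (L i) = l P ((i - 1) mod 2)"

definition locally_flat_foldable :: "mv_word \<Rightarrow> nat \<Rightarrow> bool" where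
  "locally_flat_foldable P n \<longleftrightarrow>
     (\<forall>c\<in>{1..n - 1}. odd (card {e \<in> {H c, H (c + 1), U c, L c}. crease_label P e = M}))"

fun row :: "face \<Rightarrow> nat" where
  "row (A c) = 0"
| "row (B c) = 1"

fun column :: "face \<Rightarrow> nat" where
  "column (A c) = c"
| "column (B c) = c"

text \<open>A face that is not light-up is dark-up.\<close>

definition light_up :: "face \<Rightarrow> bool" where
  "light_up x \<longleftrightarrow> even (row x + column x - 1)"

datatype target_class = S | E | W

fun target :: "crease \<Rightarrow> target_class" where
  "target (H c) = S"
| "target (U i) = (if odd i then E else W)"
| "target (L i) = (if odd i then E else W)"

text \<open>Strict total orders are lists without repetition, top first.\<close>

definition total_order_on_faces :: "nat \<Rightarrow> face list \<Rightarrow> bool" where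
  "total_order_on_faces n \<Pi> \<longleftrightarrow> distinct \<Pi> \<and> set \<Pi> = faces n"

definition position :: "'a list \<Rightarrow> 'a \<Rightarrow> nat" where
  "position \<Pi> x = length (takeWhile (\<lambda>y. y \<noteq> x) \<Pi>)"

definition precedes :: "'a list \<Rightarrow> 'a \<Rightarrow> 'a \<Rightarrow> bool" where
  "precedes \<Pi> x y \<longleftrightarrow> position \<Pi> x < position \<Pi> y"

definition precedence :: "mv_word \<Rightarrow> nat \<Rightarrow> face list \<Rightarrow> bool" where
  "precedence P n \<Pi> \<longleftrightarrow>
     (\<forall>e\<in>creases n. \<forall>x\<in>wings e. \<forall>y\<in>wings e. light_up x \<and> \<not> light_up y \<longrightarrow>
        (case crease_label P e of M \<Rightarrow> precedes \<Pi> x y | V \<Rightarrow> precedes \<Pi> y x))"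

definition noncrossing :: "nat \<Rightarrow> face list \<Rightarrow> bool" where
  "noncrossing n \<Pi> \<longleftrightarrow>
     (\<forall>e\<in>creases n. \<forall>f\<in>creases n.
        e \<noteq> f \<and> target e = target f \<and> wings e \<inter> wings f = {} \<longrightarrow>
        (\<forall>a0 a1 b0 b1.
           position \<Pi> ` wings e = {a0, a1} \<and> a0 < a1 \<and>
           position \<Pi> ` wings f = {b0, b1} \<and> b0 < b1 \<longrightarrow>
           \<not> (a0 < b0 \<and> b0 < a1 \<and> a1 < b1) \<and> \<not> (b0 < a0 \<and> a0 < b1 \<and> b1 < a1)))"

definition order_valid :: "mv_word \<Rightarrow> nat \<Rightarrow> face list \<Rightarrow> bool" where
  "order_valid P n \<Pi> \<longleftrightarrow>
     total_order_on_faces n \<Pi> \<and> precedence P n \<Pi> \<and> noncrossing n \<Pi>"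

definition F :: "mv_word \<Rightarrow> nat \<Rightarrow> face list set" where
  "F P k = (if locally_flat_foldable P (2 * k) then {\<Pi>. order_valid P (2 * k) \<Pi>} else {})"

fun phi_R :: "face \<Rightarrow> face" where
  "phi_R (A c) = B c"
| "phi_R (B c) = A c"

fun phi_H :: "nat \<Rightarrow> face \<Rightarrow> face" where
  "phi_H n (A c) = A (n + 1 - c)"
| "phi_H n (B c) = B (n + 1 - c)"

definition T_C :: "face list \<Rightarrow> face list" where
  "T_C \<Pi> = rev \<Pi>"

definition T_R :: "face list \<Rightarrow> face list" where
  "T_R \<Pi> = rev (map phi_R \<Pi>)"

definition T_H :: "nat \<Rightarrow> face list \<Rightarrow> face list" where
  "T_H n \<Pi> = rev (map (phi_H n) \<Pi>)"

definition T_CR :: "face list \<Rightarrow> face list" where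
  "T_CR \<Pi> = map phi_R \<Pi>"

definition T_CH :: "nat \<Rightarrow> face list \<Rightarrow> face list" where
  "T_CH n \<Pi> = map (phi_H n) \<Pi>"

definition Q :: "nat \<Rightarrow> face list" where
  "Q q = [A (2 * q - 1), B (2 * q - 1), B (2 * q), A (2 * q)]"

definition Omega_plus :: "nat \<Rightarrow> face list" where
  "Omega_plus k = concat (map Q [1..<k + 1])"

definition Omega_minus :: "nat \<Rightarrow> face list" where
  "Omega_minus k = map A [1..<2 * k + 1] @ map B (rev [1..<2 * k + 1])"

end

theory Submission
  imports Defs
begin

text \<open>In both \<open>Omega_plus k\<close> and \<open>Omega_minus k\<close> any two consecutive faces are the wings of
  a crease. The precedence conditions therefore already prescribe the order of consecutive faces,
  and so the whole order. The other six words arise from these two by reversal, by the row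
  exchange and by the column reflection; both exchanges of faces swap light-up and dark-up, hence
  flip the labels.\<close>

section \<open>Positions in a list\<close>

lemma position_nth:
  assumes "distinct xs" "i < length xs"
  shows "position xs (xs ! i) = i"
proof -
  have "takeWhile (\<lambda>y. y \<noteq> xs ! i) xs = take i xs"
    using assms by (intro takeWhile_eq_take_P_nth) (auto simp: nth_eq_iff_index_eq)
  then show ?thesis
    using assms by (simp add: position_def)
qed

lemma position_less_length: "x \<in> set xs \<Longrightarrow> position xs x < length xs"
  by (induction xs) (auto simp: position_def)

lemma nth_position: "x \<in> set xs \<Longrightarrow> xs ! position xs x = x"
  by (induction xs) (auto simp: position_def)

lemma inj_on_position: "inj_on (position xs) (set xs)"
  by (metis inj_onI nth_position)

lemma position_rev:
  assumes "distinct xs" "x \<in> set xs"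
  shows "position (rev xs) x = length xs - 1 - position xs x"
proof -
  have "rev xs ! (length xs - 1 - position xs x) = x"
    using assms position_less_length[of x xs] by (simp add: rev_nth nth_position Suc_diff_Suc)
  then show ?thesis
    using assms position_nth[of "rev xs" "length xs - 1 - position xs x"]
      position_less_length[of x xs] by simp
qed

lemma position_map:
  assumes "inj_on g (set xs)" "x \<in> set xs"
  shows "position (map g xs) (g x) = position xs x"
proof -
  have "takeWhile (\<lambda>y. g y \<noteq> g x) xs = takeWhile (\<lambda>y. y \<noteq> x) xs"
    using assms by (intro takeWhile_cong) (auto simp: inj_on_def)
  then show ?thesis
    by (simp add: position_def takeWhile_map comp_def)
qed

lemma distinct_if_map_eq_upt: "map r xs = [0..<m] \<Longrightarrow> distinct xs"
  by (rule distinct_map[THEN iffD1, THEN conjunct1, of r]) simp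

text \<open>Lets a closed formula \<open>r\<close> stand in for \<open>position\<close> in an
  explicit list: listing the ranks as 0, 1, 2, ... forces the entry at index \<open>i\<close> to
  have rank \<open>i\<close>.\<close>

lemma position_eq_rank:
  assumes "map r xs = [0..<m]" "x \<in> set xs"
  shows "position xs x = r x"
proof -
  obtain i where i: "i < length xs" "xs ! i = x"
    using assms(2) by (auto simp: in_set_conv_nth)
  have "length xs = m"
    using arg_cong[OF assms(1), of length] by simp
  then have "r x = i"
    using i arg_cong[OF assms(1), of "\<lambda>ys. ys ! i"] by simp
  then show ?thesis
    using i position_nth[OF distinct_if_map_eq_upt[OF assms(1)] i(1)] by simp
qed

section \<open>Order-valid orders\<close>

lemma mem_faces_iff: "x \<in> faces n \<longleftrightarrow> column x \<in> {1..n}"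
  by (cases x) (auto simp: faces_def)

lemma mem_creases_iff [simp]:
  "H c \<in> creases n \<longleftrightarrow> c \<in> {1..n}"
  "U i \<in> creases n \<longleftrightarrow> i \<in> {1..n - 1}"
  "L i \<in> creases n \<longleftrightarrow> i \<in> {1..n - 1}"
  by (auto simp: creases_def)

lemma wings_subset_faces: "e \<in> creases n \<Longrightarrow> wings e \<subseteq> faces n"
  by (auto simp: creases_def faces_def)

text \<open>A crease changes either the row or the column by one, hence the parity of their sum.
  Columns of faces are positive, so the truncated subtraction in \<open>light_up\<close> is
  exact.\<close>

lemma light_up_wings:
  assumes "e \<in> creases n" "wings e = {x, y}"
  shows "light_up x \<longleftrightarrow> \<not> light_up y"
  using assms by (cases e) (auto simp: creases_def light_up_def doubleton_eq_iff)

text \<open>Only the pattern in which \<open>e\<close> starts first; the other one is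
  \<open>crossing r f e\<close>. The parameter \<open>r\<close> can be \<open>position\<close> of a
  list as well as a rank formula.\<close>

definition crossing :: "(face \<Rightarrow> nat) \<Rightarrow> crease \<Rightarrow> crease \<Rightarrow> bool" where
  "crossing r e f \<longleftrightarrow> (\<exists>w x y z. wings e = {w, x} \<and> wings f = {y, z} \<and>
     r w < r y \<and> r y < r x \<and> r x < r z)"

lemma crossing_transfer:
  assumes "crossing r e f" "wings e' = g ` wings e" "wings f' = g ` wings f"
    and "\<And>x y. x \<in> wings e \<union> wings f \<Longrightarrow> y \<in> wings e \<union> wings f \<Longrightarrow> r x < r y \<Longrightarrow> r' (g x) < r' (g y)"
  shows "crossing r' e' f'"
proof -
  obtain w x y z where *: "wings e = {w, x}" "wings f = {y, z}" "r w < r y" "r y < r x" "r x < r z"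
    using assms(1) unfolding crossing_def by blast
  then have "wings e' = {g w, g x}" "wings f' = {g y, g z}"
    "r' (g w) < r' (g y)" "r' (g y) < r' (g x)" "r' (g x) < r' (g z)"
    using assms(2-4) by simp_all
  then show ?thesis
    unfolding crossing_def by blast
qed

text \<open>Read backwards, the crease that ended last starts first, so \<open>e\<close> and
  \<open>f\<close> trade places.\<close>

lemma crossing_reverse:
  assumes "crossing r e f"
    and "\<And>x y. x \<in> wings e \<union> wings f \<Longrightarrow> y \<in> wings e \<union> wings f \<Longrightarrow> r x < r y \<Longrightarrow> r' y < r' x"
  shows "crossing r' f e"
proof -
  obtain w x y z where *: "wings e = {w, x}" "wings f = {y, z}" "r w < r y" "r y < r x" "r x < r z"
    using assms(1) unfolding crossing_def by blast
  then have "wings f = {z, y}" "wings e = {x, w}" "r' z < r' x" "r' x < r' y" "r' y < r' w"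
    using assms(2) by auto
  then show ?thesis
    unfolding crossing_def by blast
qed

lemma wings_eq_doubleton: "x \<in> wings e \<Longrightarrow> y \<in> wings e \<Longrightarrow> x \<noteq> y \<Longrightarrow> wings e = {x, y}"
  by (cases e) auto

lemma wings_imageE:
  assumes "p ` wings e = {a, b}" "a \<noteq> b"
  obtains w x where "wings e = {w, x}" "p w = a" "p x = b"
proof -
  obtain w x where "w \<in> wings e" "x \<in> wings e" "p w = a" "p x = b"
    using assms(1) by (metis imageE insertCI)
  then show thesis
    using that wings_eq_doubleton assms(2) by blast
qed

text \<open>Quantification over all ordered pairs of creases makes the two forbidden patterns
  instances of one, and two distinct positions of a crease come from its two wings.\<close>

lemma noncrossing_iff_no_crossing:
  "noncrossing n \<Pi> \<longleftrightarrow> (\<forall>e\<in>creases n. \<forall>f\<in>creases n.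
     target e = target f \<and> wings e \<inter> wings f = {} \<longrightarrow> \<not> crossing (position \<Pi>) e f)"
  (is "?L \<longleftrightarrow> ?R")
proof
  assume L: ?L
  show ?R
  proof (intro ballI impI notI)
    fix e f
    assume ef: "e \<in> creases n" "f \<in> creases n" "target e = target f \<and> wings e \<inter> wings f = {}"
      "crossing (position \<Pi>) e f"
    then obtain w x y z where *: "wings e = {w, x}" "wings f = {y, z}"
      "position \<Pi> w < position \<Pi> y" "position \<Pi> y < position \<Pi> x" "position \<Pi> x < position \<Pi> z"
      unfolding crossing_def by blast
    \<comment> \<open>Equality would make a nonempty wing set disjoint from itself.\<close>
    have "e \<noteq> f"
      using ef * by auto
    moreover have "position \<Pi> ` wings e = {position \<Pi> w, position \<Pi> x}"
      "position \<Pi> ` wings f = {position \<Pi> y, position \<Pi> z}"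
      using * by auto
    ultimately show False
      using L ef *(3-5) less_trans[OF *(3,4)] less_trans[OF *(4,5)]
      unfolding noncrossing_def by blast
  qed
next
  assume R: ?R
  have *: "\<not> (a0 < b0 \<and> b0 < a1 \<and> a1 < b1)"
    if ef: "e \<in> creases n" "f \<in> creases n" "target e = target f" "wings e \<inter> wings f = {}"
      and e: "position \<Pi> ` wings e = {a0, a1}" "a0 < a1"
      and f: "position \<Pi> ` wings f = {b0, b1}" "b0 < b1"
    for e f a0 a1 b0 b1
  proof -
    obtain w x where "wings e = {w, x}" "position \<Pi> w = a0" "position \<Pi> x = a1"
      using wings_imageE[OF e(1)] e(2) by blast
    moreover obtain y z where "wings f = {y, z}" "position \<Pi> y = b0" "position \<Pi> z = b1"
      using wings_imageE[OF f(1)] f(2) by blast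
    ultimately show ?thesis
      using R ef unfolding crossing_def by blast
  qed
  show ?L
    unfolding noncrossing_def
  proof (intro ballI impI allI conjI; elim conjE)
    fix e f a0 a1 b0 b1
    assume "e \<in> creases n" "f \<in> creases n" "target e = target f" "wings e \<inter> wings f = {}"
      "position \<Pi> ` wings e = {a0, a1}" "a0 < a1" "position \<Pi> ` wings f = {b0, b1}" "b0 < b1"
    then show "\<not> (a0 < b0 \<and> b0 < a1 \<and> a1 < b1)" "\<not> (b0 < a0 \<and> a0 < b1 \<and> b1 < a1)"
      using *[of e f a0 a1 b0 b1] *[of f e b0 b1 a0 a1] by (simp_all add: Int_commute)
  qed
qed

text \<open>On faces \<open>position \<Omega>\<close> equals \<open>r\<close>, so validity of an
  explicit order becomes arithmetic with \<open>r\<close>.\<close>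

lemma order_validI_rank:
  assumes "map r \<Omega> = [0..<m]" "set \<Omega> = faces n"
    and prec: "\<And>e x y. e \<in> creases n \<Longrightarrow> wings e = {x, y} \<Longrightarrow> light_up x \<Longrightarrow> \<not> light_up y \<Longrightarrow>
      if crease_label P e = M then r x < r y else r y < r x"
    and cross: "\<And>e f. e \<in> creases n \<Longrightarrow> f \<in> creases n \<Longrightarrow> target e = target f \<Longrightarrow> \<not> crossing r e f"
  shows "order_valid P n \<Omega>"
proof -
  have pos: "position \<Omega> x = r x" if "x \<in> faces n" for x
    using assms(1,2) that by (simp add: position_eq_rank)
  have "distinct \<Omega>"
    using assms(1) by (rule distinct_if_map_eq_upt)
  moreover have "precedence P n \<Omega>"
    unfolding precedence_def
  proof (intro ballI impI)
    fix e x y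
    assume e: "e \<in> creases n" "x \<in> wings e" "y \<in> wings e" and lxy: "light_up x \<and> \<not> light_up y"
    then have "wings e = {x, y}"
      by (intro wings_eq_doubleton) auto
    moreover have "x \<in> faces n" "y \<in> faces n"
      using e wings_subset_faces by blast+
    ultimately show "case crease_label P e of M \<Rightarrow> precedes \<Omega> x y | V \<Rightarrow> precedes \<Omega> y x"
      using prec[OF e(1)] lxy by (auto simp: precedes_def pos split: label.splits)
  qed
  moreover have "crossing r e f"
    if "e \<in> creases n" "f \<in> creases n" "crossing (position \<Omega>) e f" for e f
    using that(3)
  proof (rule crossing_transfer[where g = id])
    fix x y
    assume "x \<in> wings e \<union> wings f" "y \<in> wings e \<union> wings f" "position \<Omega> x < position \<Omega> y"
    moreover have "wings e \<union> wings f \<subseteq> faces n"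
      using that(1,2) wings_subset_faces by simp
    ultimately show "r (id x) < r (id y)"
      by (metis id_apply pos subsetD)
  qed simp_all
  then have "noncrossing n \<Omega>"
    using cross unfolding noncrossing_iff_no_crossing by blast
  ultimately show ?thesis
    using assms(2) by (simp add: order_valid_def total_order_on_faces_def)
qed

text \<open>The values of \<open>position \<Pi>\<close> increase strictly along \<open>\<Pi>\<close>
  and, by \<open>adj\<close>, also along \<open>\<Omega>\<close>. Strictly increasing lists with the
  same elements coincide, and \<open>position \<Pi>\<close> is injective.\<close>

lemma order_valid_unique:
  assumes r: "map r \<Omega> = [0..<m]" and \<Omega>: "order_valid P n \<Omega>" and \<Pi>: "order_valid P n \<Pi>"
    and adj: "\<And>x y. x \<in> faces n \<Longrightarrow> y \<in> faces n \<Longrightarrow> r y = Suc (r x) \<Longrightarrow> \<exists>e\<in>creases n. wings e = {x, y}"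
  shows "\<Pi> = \<Omega>"
proof -
  have sets: "set \<Omega> = faces n" "set \<Pi> = faces n" and dist: "distinct \<Omega>" "distinct \<Pi>"
    using \<Omega> \<Pi> by (auto simp: order_valid_def total_order_on_faces_def)
  have "position \<Pi> (\<Omega> ! i) < position \<Pi> (\<Omega> ! Suc i)" if "Suc i < length \<Omega>" for i
  proof -
    define x y where "x = \<Omega> ! i" and "y = \<Omega> ! Suc i"
    have xy: "x \<in> faces n" "y \<in> faces n" "position \<Omega> x = i" "position \<Omega> y = Suc i"
      using that sets dist by (auto simp: x_def y_def position_nth simp flip: sets)
    then obtain e where e: "e \<in> creases n" "wings e = {x, y}"
      using adj position_eq_rank[OF r] sets by metis
    have prec: "case crease_label P e of M \<Rightarrow> precedes \<Phi> w z | V \<Rightarrow> precedes \<Phi> z w"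
      if "order_valid P n \<Phi>" "w \<in> {x, y}" "z \<in> {x, y}" "light_up w" "\<not> light_up z" for \<Phi> w z
      using that e unfolding order_valid_def precedence_def by blast
    \<comment> \<open>Exactly one of the two wings is light-up. Since \<open>\<Omega>\<close> puts
      \<open>x\<close> before \<open>y\<close>, this fixes the label of \<open>e\<close>, and the
      same label then binds \<open>\<Pi>\<close>.\<close>
    have "precedes \<Pi> x y"
    proof (cases "light_up x")
      case True
      then show ?thesis
        using light_up_wings[OF e] prec[OF \<Omega>, of x y] prec[OF \<Pi>, of x y] xy
        by (auto simp: precedes_def split: label.splits)
    next
      case False
      then show ?thesis
        using light_up_wings[OF e] prec[OF \<Omega>, of y x] prec[OF \<Pi>, of y x] xy
        by (auto simp: precedes_def split: label.splits)
    qed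
    then show ?thesis
      by (simp add: precedes_def x_def y_def)
  qed
  \<comment> \<open>Transitivity extends the comparison from neighbours to all pairs.\<close>
  then have "sorted_wrt (<) (map (position \<Pi>) \<Omega>)"
    by (simp add: sorted_wrt_iff_nth_Suc_transp)
  moreover have "map (position \<Pi>) \<Pi> = [0..<length \<Pi>]"
    using dist by (intro nth_equalityI) (auto simp: position_nth)
  then have "sorted_wrt (<) (map (position \<Pi>) \<Pi>)"
    by simp
  ultimately have "map (position \<Pi>) \<Pi> = map (position \<Pi>) \<Omega>"
    using sets by (intro strict_sorted_equal) auto
  then show ?thesis
    using map_inj_on[of "position \<Pi>" \<Pi> \<Omega>] inj_on_position[of \<Pi>] sets by simp
qed

section \<open>Local flat-foldability\<close>

text \<open>Each \<open>V\<close> contributes a factor -1, and among four labels the number of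
  \<open>V\<close> is odd exactly when the number of \<open>M\<close> is. The nested inequalities
  are exclusive ors expressing this parity.\<close>

lemma sign_mult_4_eq_minus_1_iff:
  "sign a * sign b * sign c * sign d = -1 \<longleftrightarrow> ((a = M) \<noteq> (b = M)) \<noteq> ((c = M) \<noteq> (d = M))"
  by (cases a; cases b; cases c; cases d) simp_all

text \<open>The vertex between columns \<open>c\<close> and \<open>c + 1\<close> sees both
  \<open>h\<close> labels and the \<open>u\<close> and \<open>l\<close> labels of index
  \<open>(c - 1) mod 2\<close>, so its sign product is the \<open>delta\<close> of that
  index.\<close>

lemma locally_flat_foldable_if_delta:
  assumes "delta P 0 = -1" "delta P 1 = -1"
  shows "locally_flat_foldable P n"
  unfolding locally_flat_foldable_def
proof
  fix c
  assume c: "c \<in> {1..n - 1}"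
  let ?m = "\<lambda>e. if crease_label P e = M then 1 else (0 :: nat)"
  have "card {e \<in> {H c, H (c + 1), U c, L c}. crease_label P e = M}
      = (\<Sum>e\<in>{H c, H (c + 1), U c, L c}. ?m e)"
    by (subst sum.inter_filter[symmetric]) simp_all
  also have "\<dots> = ?m (H c) + ?m (H (c + 1)) + ?m (U c) + ?m (L c)"
    by simp
  also have "odd \<dots>"
  proof (cases "odd c")
    case True
    then have "(c - 1) mod 2 = 0" "c mod 2 = 1"
      by presburger+
    then show ?thesis
      using assms(1) unfolding delta_def sign_mult_4_eq_minus_1_iff
      by (auto simp: h_def)
  next
    case False
    then have "(c - 1) mod 2 = 1" "c mod 2 = 0"
      using c by (auto, presburger)
    then show ?thesis
      using assms(2) unfolding delta_def sign_mult_4_eq_minus_1_iff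
      by (auto simp: h_def)
  qed
  finally show "odd (card {e \<in> {H c, H (c + 1), U c, L c}. crease_label P e = M})" .
qed

lemma F_eq_order_valid:
  assumes "delta P 0 = -1" "delta P 1 = -1"
  shows "F P k = {\<Pi>. order_valid P (2 * k) \<Pi>}"
  using locally_flat_foldable_if_delta[OF assms] by (simp add: F_def)

lemma F_eq_singleton:
  assumes r: "map r \<Omega> = [0..<m]" and \<Omega>: "order_valid P (2 * k) \<Omega>"
    and adj: "\<And>x y. x \<in> faces (2 * k) \<Longrightarrow> y \<in> faces (2 * k) \<Longrightarrow> r y = Suc (r x) \<Longrightarrow>
      \<exists>e\<in>creases (2 * k). wings e = {x, y}"
    and P: "delta P 0 = -1" "delta P 1 = -1"
  shows "F P k = {\<Omega>}"
proof -
  have "\<Pi> = \<Omega>" if "order_valid P (2 * k) \<Pi>" for \<Pi>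
    using order_valid_unique[OF r \<Omega> that] adj by blast
  then show ?thesis
    unfolding F_eq_order_valid[OF P] using \<Omega> by blast
qed

section \<open>Symmetries\<close>

fun flip :: "label \<Rightarrow> label" where
  "flip M = V"
| "flip V = M"

lemma flip_flip [simp]: "flip (flip a) = a"
  by (cases a) simp_all

fun flip_word :: "mv_word \<Rightarrow> mv_word" where
  "flip_word (Word a b c d e f) = Word (flip a) (flip b) (flip c) (flip d) (flip e) (flip f)"

text \<open>The word of an order relabelled by \<open>phi_R\<close>: the \<open>u\<close> and
  \<open>l\<close> labels trade places, and all labels flip because light-up and dark-up faces are
  exchanged.\<close>

fun swap_rows :: "mv_word \<Rightarrow> mv_word" where
  "swap_rows (Word a b c d e f) = Word (flip a) (flip b) (flip e) (flip f) (flip c) (flip d)"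

text \<open>For even \<open>n\<close>, sending \<open>c\<close> to \<open>n + 1 - c\<close> changes
  parity, which exchanges the \<open>h\<close> labels, while sending \<open>i\<close> to
  \<open>n - i\<close> keeps it, so the \<open>u\<close> and \<open>l\<close> labels stay in place.
  All labels flip as for \<open>phi_R\<close>.\<close>

fun reflect_columns :: "mv_word \<Rightarrow> mv_word" where
  "reflect_columns (Word a b c d e f) = Word (flip b) (flip a) (flip c) (flip d) (flip e) (flip f)"

lemma crease_label_flip_word: "crease_label (flip_word P) e = flip (crease_label P e)"
  by (cases P; cases e) (simp_all add: h_def u_def l_def)

text \<open>Reversal turns every precedence around, which flipping the labels absorbs, and turns a
  crossing of \<open>e\<close> and \<open>f\<close> into one of \<open>f\<close> and
  \<open>e\<close>.\<close>

lemma order_valid_rev: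
  assumes "order_valid P n \<Pi>"
  shows "order_valid (flip_word P) n (rev \<Pi>)"
proof -
  have \<Pi>: "distinct \<Pi>" "set \<Pi> = faces n"
    using assms by (auto simp: order_valid_def total_order_on_faces_def)
  have less: "position (rev \<Pi>) x < position (rev \<Pi>) y \<longleftrightarrow> position \<Pi> y < position \<Pi> x"
    if "x \<in> faces n" "y \<in> faces n" for x y
    using that \<Pi> position_less_length[of x \<Pi>] position_less_length[of y \<Pi>]
    by (auto simp: position_rev)
  have "precedence (flip_word P) n (rev \<Pi>)"
    unfolding precedence_def
  proof (intro ballI impI)
    fix e x y
    assume e: "e \<in> creases n" "x \<in> wings e" "y \<in> wings e" and lxy: "light_up x \<and> \<not> light_up y"
    have "case crease_label P e of M \<Rightarrow> precedes \<Pi> x y | V \<Rightarrow> precedes \<Pi> y x"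
      using assms e lxy unfolding order_valid_def precedence_def by blast
    moreover have "x \<in> faces n" "y \<in> faces n"
      using e wings_subset_faces by blast+
    ultimately show "case crease_label (flip_word P) e of
        M \<Rightarrow> precedes (rev \<Pi>) x y | V \<Rightarrow> precedes (rev \<Pi>) y x"
      by (auto simp: precedes_def less crease_label_flip_word split: label.splits)
  qed
  moreover have "noncrossing n (rev \<Pi>)"
    unfolding noncrossing_iff_no_crossing
  proof (intro ballI impI notI)
    fix e f
    assume ef: "e \<in> creases n" "f \<in> creases n" "target e = target f \<and> wings e \<inter> wings f = {}"
      and cr: "crossing (position (rev \<Pi>)) e f"
    have "wings e \<union> wings f \<subseteq> faces n"
      using ef wings_subset_faces by simp
    then have "crossing (position \<Pi>) f e"
      using crossing_reverse[OF cr] less by (metis subsetD)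
    moreover have "noncrossing n \<Pi>"
      using assms by (simp add: order_valid_def)
    ultimately show False
      using ef unfolding noncrossing_iff_no_crossing by (metis Int_commute)
  qed
  ultimately show ?thesis
    using \<Pi> by (simp add: order_valid_def total_order_on_faces_def)
qed

text \<open>Common core of the two face exchanges: \<open>g\<close> is an involution on faces that
  swaps light-up and dark-up, and \<open>s\<close> is its action on creases. The order itself is
  carried along, so only the labels flip.\<close>

lemma order_valid_map:
  assumes valid: "order_valid P n \<Pi>"
    and g: "g ` faces n \<subseteq> faces n" "\<And>x. x \<in> faces n \<Longrightarrow> g (g x) = x"
      "\<And>x. x \<in> faces n \<Longrightarrow> light_up (g x) \<longleftrightarrow> \<not> light_up x"
    and s: "s ` creases n \<subseteq> creases n" "\<And>e. e \<in> creases n \<Longrightarrow> wings (s e) = g ` wings e"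
      "\<And>e. e \<in> creases n \<Longrightarrow> target (s e) = target e"
      "\<And>e. e \<in> creases n \<Longrightarrow> crease_label P' e = flip (crease_label P (s e))"
  shows "order_valid P' n (map g \<Pi>)"
proof -
  have \<Pi>: "distinct \<Pi>" "set \<Pi> = faces n"
    using valid by (auto simp: order_valid_def total_order_on_faces_def)
  have inj: "inj_on g (faces n)"
    using g(2) by (metis inj_onI)
  have surj: "g ` faces n = faces n"
    using g(1,2) by (metis image_eqI image_subset_iff subsetI subset_antisym)
  have gx: "g x \<in> faces n" if "x \<in> faces n" for x
    using that g(1) by blast
  \<comment> \<open>As \<open>x = g (g x)\<close>, the entry \<open>x\<close> of the new list comes
    from \<open>g x\<close>.\<close>
  have pos: "position (map g \<Pi>) x = position \<Pi> (g x)" if "x \<in> faces n" for x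
    using position_map[of g \<Pi> "g x"] inj \<Pi> g(2)[OF that] gx[OF that] by simp
  have "precedence P' n (map g \<Pi>)"
    unfolding precedence_def
  proof (intro ballI impI)
    fix e x y
    assume e: "e \<in> creases n" "x \<in> wings e" "y \<in> wings e" and lxy: "light_up x \<and> \<not> light_up y"
    have xy: "x \<in> faces n" "y \<in> faces n"
      using e wings_subset_faces by blast+
    have "s e \<in> creases n" "g x \<in> wings (s e)" "g y \<in> wings (s e)"
      using e s by auto
    moreover have "light_up (g y)" "\<not> light_up (g x)"
      using lxy xy g(3) by auto
    ultimately have "case crease_label P (s e) of
        M \<Rightarrow> precedes \<Pi> (g y) (g x) | V \<Rightarrow> precedes \<Pi> (g x) (g y)"
      using valid unfolding order_valid_def precedence_def by blast
    then show "case crease_label P' e of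
        M \<Rightarrow> precedes (map g \<Pi>) x y | V \<Rightarrow> precedes (map g \<Pi>) y x"
      using xy e by (auto simp: precedes_def pos s(4) split: label.splits)
  qed
  moreover have "noncrossing n (map g \<Pi>)"
    unfolding noncrossing_iff_no_crossing
  proof (intro ballI impI notI)
    fix e f
    assume ef: "e \<in> creases n" "f \<in> creases n" "target e = target f \<and> wings e \<inter> wings f = {}"
      and cr: "crossing (position (map g \<Pi>)) e f"
    have sub: "wings e \<union> wings f \<subseteq> faces n"
      using ef wings_subset_faces by simp
    have "crossing (position \<Pi>) (s e) (s f)"
    proof (rule crossing_transfer[OF cr s(2)[OF ef(1)] s(2)[OF ef(2)]])
      fix x y
      assume "x \<in> wings e \<union> wings f" "y \<in> wings e \<union> wings f"
        "position (map g \<Pi>) x < position (map g \<Pi>) y"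
      then show "position \<Pi> (g x) < position \<Pi> (g y)"
        using sub by (metis pos subsetD)
    qed
    moreover have "wings (s e) \<inter> wings (s f) = {}"
      using ef s(2) inj wings_subset_faces by (metis image_empty inj_on_image_Int)
    moreover have "s e \<in> creases n" "s f \<in> creases n" "target (s e) = target (s f)"
      using ef s(1,3) by auto
    ultimately show False
      using valid unfolding order_valid_def noncrossing_iff_no_crossing by blast
  qed
  ultimately show ?thesis
    using \<Pi> inj surj by (simp add: order_valid_def total_order_on_faces_def distinct_map)
qed

section \<open>Row exchange and column reflection\<close>

fun crease_R :: "crease \<Rightarrow> crease" where
  "crease_R (H c) = H c"
| "crease_R (U i) = L i"
| "crease_R (L i) = U i"

text \<open>Columns \<open>i\<close> and \<open>i + 1\<close> go to \<open>n + 1 - i\<close> and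
  \<open>n - i\<close>; the image crease is indexed by the smaller one.\<close>

fun crease_H :: "nat \<Rightarrow> crease \<Rightarrow> crease" where
  "crease_H n (H c) = H (n + 1 - c)"
| "crease_H n (U i) = U (n - i)"
| "crease_H n (L i) = L (n - i)"

lemma order_valid_map_phi_R:
  assumes "order_valid P n \<Pi>"
  shows "order_valid (swap_rows P) n (map phi_R \<Pi>)"
proof (rule order_valid_map[where s = crease_R, OF assms])
  show "crease_label (swap_rows P) e = flip (crease_label P (crease_R e))" for e
    by (cases P; cases e) (simp_all add: h_def u_def l_def)
  show "wings (crease_R e) = phi_R ` wings e" for e
    by (cases e) auto
  show "target (crease_R e) = target e" for e
    by (cases e) auto
qed (auto simp: faces_def creases_def light_up_def)

lemma order_valid_map_phi_H:
  assumes "order_valid P n \<Pi>" "even n"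
  shows "order_valid (reflect_columns P) n (map (phi_H n) \<Pi>)"
proof (rule order_valid_map[where s = "crease_H n", OF assms(1)])
  fix e
  assume e: "e \<in> creases n"
  \<comment> \<open>The crease \<open>i\<close> and its mirror image \<open>n - i\<close> have the
    same label index because \<open>n\<close> is even.\<close>
  have inner: "even (n - i - 1) \<longleftrightarrow> even (i - 1)" if "i \<in> {1..n - 1}" for i
  proof -
    have i: "i \<noteq> 0" "Suc i \<le> n"
      using that by auto
    then obtain d where "n = Suc i + d"
      using le_Suc_ex by blast
    then show ?thesis
      using i assms(2) by auto
  qed
  show "crease_label (reflect_columns P) e = flip (crease_label P (crease_H n e))"
  proof (cases e)
    case (H c)
    then have c: "c \<noteq> 0" "c \<le> n"
      using e by (auto simp: creases_def)
    then obtain d where "n = c + d"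
      using le_Suc_ex by blast
    \<comment> \<open>The mirror image of \<open>H c\<close> has index
      \<open>(n + 1 - c) - 1 = n - c\<close>, of the opposite parity.\<close>
    then have "even (n - c) \<longleftrightarrow> odd (c - 1)"
      using c assms(2) by auto
    then show ?thesis
      using H by (cases P) (auto simp: h_def)
  next
    case (U i)
    then have "i \<in> {1..n - 1}"
      using e by (auto simp: creases_def)
    then show ?thesis
      using U inner[of i] by (cases P) (auto simp: u_def)
  next
    case (L i)
    then have "i \<in> {1..n - 1}"
      using e by (auto simp: creases_def)
    then show ?thesis
      using L inner[of i] by (cases P) (auto simp: l_def)
  qed
  show "wings (crease_H n e) = phi_H n ` wings e"
    using e by (cases e) (auto simp: Suc_diff_le)
  show "target (crease_H n e) = target e"
    using e assms(2) by (cases e) auto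
next
  show "light_up (phi_H n x) \<longleftrightarrow> \<not> light_up x" if "x \<in> faces n" for x
    using that assms(2) by (cases x) (auto simp: mem_faces_iff light_up_def)
  show "phi_H n ` faces n \<subseteq> faces n"
  proof (rule image_subsetI)
    show "phi_H n x \<in> faces n" if "x \<in> faces n" for x
      using that by (cases x) (auto simp: mem_faces_iff)
  qed
  show "phi_H n (phi_H n x) = x" if "x \<in> faces n" for x
    using that by (cases x) (auto simp: mem_faces_iff)
  show "crease_H n ` creases n \<subseteq> creases n"
  proof (rule image_subsetI)
    show "crease_H n e \<in> creases n" if "e \<in> creases n" for e
      using that by (cases e) auto
  qed
qed

text \<open>The four sign changes cancel, and the product is symmetric in the two \<open>h\<close>
  labels and in \<open>u\<close> and \<open>l\<close>.\<close>

lemma delta_symmetries [simp]: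
  "i < 2 \<Longrightarrow> delta (flip_word P) i = delta P i"
  "i < 2 \<Longrightarrow> delta (swap_rows P) i = delta P i"
  "i < 2 \<Longrightarrow> delta (reflect_columns P) i = delta P i"
proof -
  have sign_flip: "sign (flip a) = - sign a" for a
    by (cases a) simp_all
  show "i < 2 \<Longrightarrow> delta (flip_word P) i = delta P i"
    "i < 2 \<Longrightarrow> delta (swap_rows P) i = delta P i"
    "i < 2 \<Longrightarrow> delta (reflect_columns P) i = delta P i"
    by (cases P; simp add: delta_def h_def u_def l_def sign_flip)+
qed

text \<open>\<open>T\<close> carries valid orders both ways and undoes itself, so it transports the
  singleton. The involution law is asked for valid orders only, since \<open>phi_H\<close> truncates
  at columns beyond the sheet.\<close>

lemma F_symmetry:
  assumes F: "F P k = {\<Omega>}" and P: "delta P 0 = -1" "delta P 1 = -1"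
    and P': "delta P' 0 = -1" "delta P' 1 = -1"
    and T: "\<And>\<Pi>. order_valid P (2 * k) \<Pi> \<Longrightarrow> order_valid P' (2 * k) (T \<Pi>)"
      "\<And>\<Pi>. order_valid P' (2 * k) \<Pi> \<Longrightarrow> order_valid P (2 * k) (T \<Pi>)"
      "\<And>\<Pi>. order_valid P' (2 * k) \<Pi> \<Longrightarrow> T (T \<Pi>) = \<Pi>"
  shows "F P' k = {T \<Omega>}"
proof -
  have \<Omega>: "{\<Pi>. order_valid P (2 * k) \<Pi>} = {\<Omega>}"
    using F F_eq_order_valid[OF P] by simp
  then have "order_valid P' (2 * k) (T \<Omega>)"
    using T(1) by blast
  moreover have "\<Pi> = T \<Omega>" if "order_valid P' (2 * k) \<Pi>" for \<Pi>
  proof -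
    have "T \<Pi> = \<Omega>"
      using T(2)[OF that] \<Omega> by blast
    then show ?thesis
      using T(3)[OF that] by simp
  qed
  ultimately show ?thesis
    unfolding F_eq_order_valid[OF P'] by blast
qed

section \<open>State sets under the symmetries\<close>

lemma F_flip_word:
  assumes "F P k = {\<Omega>}" "delta P 0 = -1" "delta P 1 = -1"
  shows "F (flip_word P) k = {T_C \<Omega>}"
proof (rule F_symmetry[OF assms])
  have "flip_word (flip_word P) = P"
    by (cases P) simp
  then show "order_valid P (2 * k) (T_C \<Pi>)" if "order_valid (flip_word P) (2 * k) \<Pi>" for \<Pi>
    using order_valid_rev[OF that] by (simp add: T_C_def)
qed (use assms in \<open>simp_all add: order_valid_rev T_C_def\<close>)

lemma F_swap_rows:
  assumes "F P k = {\<Omega>}" "delta P 0 = -1" "delta P 1 = -1"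
  shows "F (swap_rows P) k = {T_CR \<Omega>}"
proof (rule F_symmetry[OF assms])
  have "swap_rows (swap_rows P) = P"
    by (cases P) simp
  then show "order_valid P (2 * k) (T_CR \<Pi>)" if "order_valid (swap_rows P) (2 * k) \<Pi>" for \<Pi>
    using order_valid_map_phi_R[OF that] by (simp add: T_CR_def)
  have "phi_R (phi_R x) = x" for x
    by (cases x) simp_all
  then show "T_CR (T_CR \<Pi>) = \<Pi>" for \<Pi>
    by (simp add: T_CR_def comp_def)
qed (use assms in \<open>simp_all add: order_valid_map_phi_R T_CR_def\<close>)

lemma F_reflect_columns:
  assumes "F P k = {\<Omega>}" "delta P 0 = -1" "delta P 1 = -1"
  shows "F (reflect_columns P) k = {T_CH (2 * k) \<Omega>}"
proof (rule F_symmetry[OF assms])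
  have "reflect_columns (reflect_columns P) = P"
    by (cases P) simp
  then show "order_valid P (2 * k) (T_CH (2 * k) \<Pi>)"
    if "order_valid (reflect_columns P) (2 * k) \<Pi>" for \<Pi>
    using order_valid_map_phi_H[OF that] by (simp add: T_CH_def)
  have "phi_H (2 * k) (phi_H (2 * k) x) = x" if "x \<in> faces (2 * k)" for x
    using that by (cases x) (auto simp: mem_faces_iff)
  then show "T_CH (2 * k) (T_CH (2 * k) \<Pi>) = \<Pi>"
    if "order_valid (reflect_columns P) (2 * k) \<Pi>" for \<Pi>
    using that by (auto simp: T_CH_def order_valid_def total_order_on_faces_def intro: map_idI)
qed (use assms in \<open>simp_all add: order_valid_map_phi_H T_CH_def\<close>)

section \<open>The two base words\<close>

text \<open>Positions in \<open>Omega_plus\<close>, counted from 0: the block \<open>Q q\<close>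
  fills \<open>4 * q - 4\<close> to \<open>4 * q - 1\<close>, rewritten in terms of the column
  \<open>2 * q - 1\<close> or \<open>2 * q\<close>.\<close>

fun rank_plus :: "face \<Rightarrow> nat" where
  "rank_plus (A c) = (if odd c then 2 * c - 2 else 2 * c - 1)"
| "rank_plus (B c) = (if odd c then 2 * c - 1 else 2 * c - 2)"

text \<open>Positions in \<open>Omega_minus\<close>, counted from 0: the \<open>A\<close> row fills
  the first \<open>2 * k\<close> places, and the \<open>B\<close> row runs backwards to end with
  \<open>B 1\<close> at \<open>4 * k - 1\<close>.\<close>

fun rank_minus :: "nat \<Rightarrow> face \<Rightarrow> nat" where
  "rank_minus k (A c) = c - 1"
| "rank_minus k (B c) = 4 * k - c"

lemma map_rank_plus: "map rank_plus (Omega_plus k) = [0..<4 * k]"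
proof (induction k)
  case 0
  then show ?case by (simp add: Omega_plus_def)
next
  case (Suc k)
  have "[0..<4 * Suc k] = [0..<4 * k] @ [4 * k, 4 * k + 1, 4 * k + 2, 4 * k + 3]"
    by (simp add: numeral_eq_Suc)
  moreover have "map rank_plus (Q (Suc k)) = [4 * k, 4 * k + 1, 4 * k + 2, 4 * k + 3]"
    by (simp add: Q_def)
  moreover have "Omega_plus (Suc k) = Omega_plus k @ Q (Suc k)"
    by (simp add: Omega_plus_def)
  ultimately show ?case
    using Suc by (simp only: map_append)
qed

lemma set_Omega_plus: "set (Omega_plus k) = faces (2 * k)"
proof (induction k)
  case 0
  then show ?case by (simp add: Omega_plus_def faces_def)
next
  case (Suc k)
  have "set (Omega_plus (Suc k)) = set (Omega_plus k) \<union> set (Q (Suc k))"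
    by (simp add: Omega_plus_def)
  then show ?case
    using Suc by (auto simp: Q_def faces_def atLeastAtMostSuc_conv)
qed

lemma map_rank_minus: "map (rank_minus k) (Omega_minus k) = [0..<4 * k]"
proof -
  have "map (rank_minus k) (map A [1..<2 * k + 1]) = [0..<2 * k]"
    by (rule nth_equalityI) (simp_all del: upt_Suc)
  moreover have "map (rank_minus k) (map B (rev [1..<2 * k + 1])) = [2 * k..<4 * k]"
    by (rule nth_equalityI) (simp_all add: rev_nth del: upt_Suc)
  moreover have "[0..<4 * k] = [0..<2 * k] @ [2 * k..<4 * k]"
    using upt_add_eq_append[of 0 "2 * k" "2 * k"] by simp
  ultimately show ?thesis
    unfolding Omega_minus_def by (simp only: map_append)
qed

lemma set_Omega_minus: "set (Omega_minus k) = faces (2 * k)"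
  by (auto simp: Omega_minus_def faces_def)

lemma pred_mod_2: "Suc 0 \<le> i \<Longrightarrow> (i - Suc 0) mod 2 = (if odd i then 0 else 1)"
  by (cases i) (auto simp: mod2_eq_if)

text \<open>Wings of an \<open>H\<close> crease are neighbours. In class \<open>E\<close>,
  \<open>L i\<close> nests inside \<open>U i\<close>; in class \<open>W\<close>, \<open>U i\<close>
  nests inside \<open>L i\<close>. Both fill positions \<open>2 * i - 2\<close> to
  \<open>2 * i + 1\<close>, intervals that are disjoint for different \<open>i\<close> of equal
  parity.\<close>

lemma order_valid_Omega_plus: "order_valid (Word M M M V V M) (2 * k) (Omega_plus k)"
proof (rule order_validI_rank[OF map_rank_plus set_Omega_plus])
  show "if crease_label (Word M M M V V M) e = M then rank_plus x < rank_plus y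
      else rank_plus y < rank_plus x"
    if "e \<in> creases (2 * k)" "wings e = {x, y}" "light_up x" "\<not> light_up y" for e x y
    using that
    by (cases e) (auto simp: doubleton_eq_iff light_up_def h_def u_def l_def pred_mod_2)
  show "\<not> crossing rank_plus e f"
    if "e \<in> creases (2 * k)" "f \<in> creases (2 * k)" "target e = target f" for e f
    using that
    by (cases e; cases f)
      (auto simp: crossing_def doubleton_eq_iff elim!: oddE evenE split: if_splits)
qed

text \<open>The \<open>H\<close> creases are nested around the middle of the list, and every
  \<open>U\<close> or \<open>L\<close> crease joins neighbours, between which no position
  lies.\<close>

lemma order_valid_Omega_minus: "order_valid (Word M V M V M V) (2 * k) (Omega_minus k)"
proof (rule order_validI_rank[OF map_rank_minus set_Omega_minus])
  show "if crease_label (Word M V M V M V) e = M then rank_minus k x < rank_minus k y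
      else rank_minus k y < rank_minus k x"
    if "e \<in> creases (2 * k)" "wings e = {x, y}" "light_up x" "\<not> light_up y" for e x y
    using that
    by (cases e) (auto simp: doubleton_eq_iff light_up_def h_def u_def l_def pred_mod_2)
  show "\<not> crossing (rank_minus k) e f"
    if "e \<in> creases (2 * k)" "f \<in> creases (2 * k)" "target e = target f" for e f
    using that
    by (cases e; cases f) (auto simp: crossing_def doubleton_eq_iff)
qed

text \<open>Neighbours are joined by \<open>H\<close>, \<open>L\<close>, \<open>H\<close> inside a
  block and by \<open>U\<close> from one block to the next.\<close>

lemma adjacent_rank_plus:
  assumes "x \<in> faces n" "y \<in> faces n" "rank_plus y = Suc (rank_plus x)"
  shows "\<exists>e\<in>creases n. wings e = {x, y}"
proof -
  have cols: "column x \<in> {1..n}" "column y \<in> {1..n}"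
    using assms(1,2) by (simp_all add: mem_faces_iff)
  show ?thesis
  proof (cases x; cases y)
    fix c d
    assume xy: "x = A c" "y = A d"
    then have "d = Suc c"
      using assms(3) cols by (cases "odd c"; cases "odd d"; auto elim!: oddE evenE; presburger)
    then show ?thesis
      using xy cols by (intro bexI[of _ "U c"]) auto
  next
    fix c d
    assume xy: "x = B c" "y = B d"
    then have "d = Suc c"
      using assms(3) cols by (cases "odd c"; cases "odd d"; auto elim!: oddE evenE; presburger)
    then show ?thesis
      using xy cols by (intro bexI[of _ "L c"]) auto
  next
    fix c d
    assume xy: "x = A c" "y = B d"
    then have "d = c"
      using assms(3) cols by (cases "odd c"; cases "odd d"; auto elim!: oddE evenE; presburger)
    then show ?thesis
      using xy cols by (intro bexI[of _ "H c"]) auto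
  next
    fix c d
    assume xy: "x = B c" "y = A d"
    then have "d = c"
      using assms(3) cols by (cases "odd c"; cases "odd d"; auto elim!: oddE evenE; presburger)
    then show ?thesis
      using xy cols by (intro bexI[of _ "H c"]) auto
  qed
qed

text \<open>The list follows the \<open>U\<close> creases to the last column, crosses there by
  \<open>H\<close>, and returns along the \<open>L\<close> creases.\<close>

lemma adjacent_rank_minus:
  assumes "x \<in> faces (2 * k)" "y \<in> faces (2 * k)" "rank_minus k y = Suc (rank_minus k x)"
  shows "\<exists>e\<in>creases (2 * k). wings e = {x, y}"
proof -
  have cols: "column x \<in> {1..2 * k}" "column y \<in> {1..2 * k}"
    using assms(1,2) by (simp_all add: mem_faces_iff)
  show ?thesis
  proof (cases x; cases y)
    fix c d
    assume xy: "x = A c" "y = A d"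
    then have "d = Suc c"
      using assms(3) cols by auto
    then show ?thesis
      using xy cols by (intro bexI[of _ "U c"]) auto
  next
    fix c d
    assume xy: "x = B c" "y = B d"
    \<comment> \<open>Ranks in the \<open>B\<close> row decrease with the column, so
      \<open>d\<close> is the smaller one and indexes the crease.\<close>
    then have "c = Suc d"
      using assms(3) cols by auto
    then show ?thesis
      using xy cols by (intro bexI[of _ "L d"]) auto
  next
    fix c d
    assume xy: "x = A c" "y = B d"
    \<comment> \<open>The ranks give \<open>c + d = 4 * k\<close> with both columns at most
      \<open>2 * k\<close>, so both equal \<open>2 * k\<close>.\<close>
    then have "d = c"
      using assms(3) cols by auto
    then show ?thesis
      using xy cols by (intro bexI[of _ "H c"]) auto
  next
    fix c d
    assume "x = B c" "y = A d"
    \<comment> \<open>Impossible: ranks in the \<open>B\<close> row are at least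
      \<open>2 * k\<close>, those in the \<open>A\<close> row below it.\<close>
    then show ?thesis
      using assms(3) cols by auto
  qed
qed

section \<open>The base singletons and the eight words\<close>

lemma F_Omega_plus: "F (Word M M M V V M) k = {Omega_plus k}"
proof (rule F_eq_singleton[OF map_rank_plus order_valid_Omega_plus])
  show "\<exists>e\<in>creases (2 * k). wings e = {x, y}"
    if "x \<in> faces (2 * k)" "y \<in> faces (2 * k)" "rank_plus y = Suc (rank_plus x)" for x y
    using that by (rule adjacent_rank_plus)
qed (simp_all add: delta_def h_def u_def l_def)

lemma F_Omega_minus: "F (Word M V M V M V) k = {Omega_minus k}"
proof (rule F_eq_singleton[OF map_rank_minus order_valid_Omega_minus])
  show "\<exists>e\<in>creases (2 * k). wings e = {x, y}"
    if "x \<in> faces (2 * k)" "y \<in> faces (2 * k)" "rank_minus k y = Suc (rank_minus k x)" for x y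
    using that by (rule adjacent_rank_minus)
qed (simp_all add: delta_def h_def u_def l_def)

text \<open>Three independent sign conditions leave 8 of the 64 words; this shows that the list of
  words is complete.\<close>

lemma words_with_signs_minus_1:
  "{P. delta P 0 = -1 \<and> delta P 1 = -1 \<and> tau P = -1}
    = {Word M M M V V M, Word M V M V M V,
       Word M M V M M V, Word V V M V V M, Word V V V M M V,
       Word V M M V M V, Word V M V M V M, Word M V V M V M}"
proof (rule set_eqI)
  fix P
  show "P \<in> {P. delta P 0 = -1 \<and> delta P 1 = -1 \<and> tau P = -1} \<longleftrightarrow>
    P \<in> {Word M M M V V M, Word M V M V M V, Word M M V M M V, Word V V M V V M,
      Word V V V M M V, Word V M M V M V, Word V M V M V M, Word M V V M V M}"
  proof (cases P)
    case (Word a b c d e f)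
    then show ?thesis
      by (cases a; cases b; cases c; cases d; cases e; cases f)
        (simp_all add: delta_def tau_def h_def u_def l_def)
  qed
qed

theorem theorem5p1:
  fixes k n :: nat
  assumes "k \<ge> 2" and "n = 2 * k"
  shows "F (Word M M M V V M) k = {Omega_plus k}
    \<and> F (Word M V M V M V) k = {Omega_minus k}
    \<and> {P. delta P 0 = -1 \<and> delta P 1 = -1 \<and> tau P = -1}
      = {Word M M M V V M, Word M V M V M V,
         Word M M V M M V, Word V V M V V M, Word V V V M M V,
         Word V M M V M V, Word V M V M V M, Word M V V M V M}
    \<and> F (Word M M V M M V) k = {T_R (Omega_plus k)}
    \<and> F (Word V V M V V M) k = {T_CR (Omega_plus k)}
    \<and> F (Word V V V M M V) k = {T_C (Omega_plus k)}
    \<and> F (Word V M M V M V) k = {T_H n (Omega_minus k)}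
    \<and> F (Word V M V M V M) k = {T_C (Omega_minus k)}
    \<and> F (Word M V V M V M) k = {T_CH n (Omega_minus k)}"
proof -
  let ?P = "Word M M M V V M" and ?N = "Word M V M V M V"
  have d: "delta ?P 0 = -1" "delta ?P 1 = -1" "delta ?N 0 = -1" "delta ?N 1 = -1"
    by (simp_all add: delta_def h_def u_def l_def)
  have CR: "F (swap_rows ?P) k = {T_CR (Omega_plus k)}"
    using F_swap_rows[OF F_Omega_plus d(1,2)] .
  have CH: "F (reflect_columns ?N) k = {T_CH n (Omega_minus k)}"
    using F_reflect_columns[OF F_Omega_minus d(3,4)] assms(2) by simp
  \<comment> \<open>\<open>T_R\<close> is \<open>T_C\<close> after \<open>T_CR\<close>. Keeping
    \<open>swap_rows\<close> folded lets \<open>delta_symmetries\<close> reduce the side conditions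
    to those of \<open>?P\<close>.\<close>
  have R: "F (flip_word (swap_rows ?P)) k = {T_R (Omega_plus k)}"
    using F_flip_word[OF CR] d by (simp add: T_C_def T_CR_def T_R_def del: swap_rows.simps)
  have Hc: "F (flip_word (reflect_columns ?N)) k = {T_H n (Omega_minus k)}"
    using F_flip_word[OF CH] d by (simp add: T_C_def T_CH_def T_H_def del: reflect_columns.simps)
  show ?thesis
    using F_Omega_plus F_Omega_minus words_with_signs_minus_1 CR CH R Hc
      F_flip_word[OF F_Omega_plus d(1,2)] F_flip_word[OF F_Omega_minus d(3,4)]
    by simp
qed

end
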